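(* Let $R_{\text{approval}}$ be the approval voting rule, which on every instance selects a candidate approved by the highest number of voters, breaking ties arbitrarily. For each $s\in(0,1)$, we have $\mathrm{FVR}(R_{\text{approval}},s)=\frac{1}{1+s}$.
   Context: An (approval) instance consists of a finite non-empty set $N$ of $n$ voters, a finite non-empty set $M$ of $m$ candidates, and an approval set $A_i\subseteq M$ for each voter $i\in N$. A single-winner rule $R$ selects, for every instance (for all $n$ and $m$), a single candidate in $M$. For a voter $i$, let $f_i=|A_i|/m$; for $s\in(0,1)$, voter $i$ is $s$-flexible if $f_i\ge s$. Voter $i$ approves candidate $a$ if $a\in A_i$. For a rule $R$ and $s\in(0,1)$, $\mathrm{FVR}(R,s)$ is the smallest $r\in[0,1]$ such that for every instance (over all $n$, $m$ and all approval sets), whenever a group of strictly more than $rn$ voters are all $s$-flexible, at least one voter in the group approves the candidate chosen by $R$ on that instance. (This minimum always exists.) *)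

theory Defs
  imports Complex_Main "HOL-Library.FuncSet" "HOL-Library.Infinite_Typeclass"
begin

text \<open>
  Voters and candidates are drawn from infinite types, so that finite sets of voters and of
  candidates of every size are available. The approval sets of an instance are required to be
  \<open>undefined\<close> outside the set of voters, so a rule cannot depend on anything but the instance.
\<close>

definition approval_instance :: "'v set \<Rightarrow> 'c set \<Rightarrow> ('v \<Rightarrow> 'c set) \<Rightarrow> bool" where
  "approval_instance N M A \<longleftrightarrow>
     finite N \<and> N \<noteq> {} \<and> finite M \<and> M \<noteq> {} \<and> A \<in> N \<rightarrow>\<^sub>E Pow M"

type_synonym ('v, 'c) rule = "'v set \<Rightarrow> 'c set \<Rightarrow> ('v \<Rightarrow> 'c set) \<Rightarrow> 'c"

definition single_winner_rule :: "('v::infinite, 'c::infinite) rule \<Rightarrow> bool" where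
  "single_winner_rule R \<longleftrightarrow> (\<forall>N M A. approval_instance N M A \<longrightarrow> R N M A \<in> M)"

definition flexibility :: "'c set \<Rightarrow> ('v \<Rightarrow> 'c set) \<Rightarrow> 'v \<Rightarrow> real" where
  "flexibility M A i = real (card (A i)) / real (card M)"

definition flexible :: "real \<Rightarrow> 'c set \<Rightarrow> ('v \<Rightarrow> 'c set) \<Rightarrow> 'v \<Rightarrow> bool" where
  "flexible s M A i \<longleftrightarrow> flexibility M A i \<ge> s"

definition represents_flexible_groups ::
    "('v::infinite, 'c::infinite) rule \<Rightarrow> real \<Rightarrow> real \<Rightarrow> bool" where
  "represents_flexible_groups R s r \<longleftrightarrow>
     (\<forall>N M A. approval_instance N M A \<longrightarrow>
        (\<forall>G\<subseteq>N. real (card G) > r * real (card N) \<longrightarrow> (\<forall>i\<in>G. flexible s M A i) \<longrightarrow>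
           (\<exists>i\<in>G. R N M A \<in> A i)))"

definition FVR :: "('v::infinite, 'c::infinite) rule \<Rightarrow> real \<Rightarrow> real" where
  "FVR R s = (LEAST r. r \<in> {0..1} \<and> represents_flexible_groups R s r)"

text \<open>The minimum exists for every rule, so \<open>LEAST\<close> never denotes an unspecified number here.\<close>

lemma FVR_minimum_exists:
  fixes R :: "('v::infinite, 'c::infinite) rule"
  shows "\<exists>r. (r \<in> {0..1} \<and> represents_flexible_groups R s r) \<and>
             (\<forall>r'. r' \<in> {0..1} \<and> represents_flexible_groups R s r' \<longrightarrow> r \<le> r')"
proof -
  define P where "P r \<longleftrightarrow> r \<in> {0..1} \<and> represents_flexible_groups R s r" for r
  define S where "S = {r. P r}"
  have "P 1"
    unfolding P_def represents_flexible_groups_def approval_instance_def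
    by (auto simp: not_less dest: card_mono)
  hence ne: "S \<noteq> {}" by (auto simp: S_def)
  have bdd: "bdd_below S"
    by (rule bdd_belowI[of _ 0]) (auto simp: S_def P_def)
  have lower: "Inf S \<le> r" if "P r" for r
    using that bdd by (auto simp: S_def intro: cInf_lower)
  have "0 \<le> Inf S"
    by (rule cInf_greatest[OF ne]) (auto simp: S_def P_def)
  moreover have "Inf S \<le> 1" using lower \<open>P 1\<close> .
  moreover have "represents_flexible_groups R s (Inf S)"
    unfolding represents_flexible_groups_def
  proof (intro allI impI)
    fix N :: "'v set" and M :: "'c set" and A G
    assume inst: "approval_instance N M A" and G: "G \<subseteq> N"
      and big: "real (card G) > Inf S * real (card N)" and flex: "\<forall>i\<in>G. flexible s M A i"
    have pos: "real (card N) > 0"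
      using inst by (auto simp: approval_instance_def card_gt_0_iff)
    have "Inf S < real (card G) / real (card N)"
      using big pos by (simp add: field_simps)
    then obtain r where "P r" and "r < real (card G) / real (card N)"
      using cInf_lessD[OF ne] by (auto simp: S_def)
    hence "real (card G) > r * real (card N)" using pos by (simp add: field_simps)
    with \<open>P r\<close> inst G flex show "\<exists>i\<in>G. R N M A \<in> A i"
      unfolding P_def represents_flexible_groups_def by blast
  qed
  ultimately show ?thesis using lower unfolding P_def by auto
qed

definition approval_score :: "'v set \<Rightarrow> ('v \<Rightarrow> 'c set) \<Rightarrow> 'c \<Rightarrow> nat" where
  "approval_score N A c = card {i \<in> N. c \<in> A i}"

text \<open>Ties are broken arbitrarily: every such \<open>R\<close> is a version of the approval voting rule.\<close>

definition approval_voting_rule :: "('v::infinite, 'c::infinite) rule \<Rightarrow> bool" where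
  "approval_voting_rule R \<longleftrightarrow> single_winner_rule R \<and>
     (\<forall>N M A. approval_instance N M A \<longrightarrow>
        (\<forall>c\<in>M. approval_score N A c \<le> approval_score N A (R N M A)))"

end

theory Submission
  imports Defs
begin

text \<open>
  Upper bound: if no member of a group \<open>G\<close> of \<open>s\<close>-flexible voters approves the winner, then the
  winner's score is at most \<open>n - |G|\<close>, while by double counting some candidate has score at least
  \<open>s |G|\<close>; hence \<open>(1 + s) |G| \<le> n\<close>.

  Lower bound: let \<open>g\<close> voters approve \<open>p \<approx> s g\<close> candidates each among \<open>g\<close> candidates, arranged
  cyclically so that each of these gets only \<open>p\<close> approvals, and let \<open>p + 1\<close> further voters approve
  just one extra candidate. That candidate wins, and the \<open>g\<close> unhappy voters form a
  fraction \<open>g / (g + p + 1)\<close> of the voters, which tends to \<open>1 / (1 + s)\<close>.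
\<close>

lemma approval_voting_represents_flexible_groups:
  fixes R :: "('v::infinite, 'c::infinite) rule"
  assumes R: "approval_voting_rule R" and s: "s > -1"
  shows "represents_flexible_groups R s (1 / (1 + s))"
  unfolding represents_flexible_groups_def
proof (intro allI impI)
  fix N :: "'v set" and M :: "'c set" and A G
  assume inst: "approval_instance N M A" and G: "G \<subseteq> N"
    and big: "real (card G) > 1 / (1 + s) * real (card N)" and flex: "\<forall>i\<in>G. flexible s M A i"
  define w where "w = R N M A"
  have fin: "finite N" "finite M" "finite G" and M: "card M > 0"
    using inst G by (auto simp: approval_instance_def card_gt_0_iff intro: finite_subset)
  have AM: "A i \<subseteq> M" if "i \<in> N" for i
    using inst that by (auto simp: approval_instance_def)
  show "\<exists>i\<in>G. R N M A \<in> A i"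
  proof (rule ccontr)
    assume none: "\<not> ?thesis"
    \<comment> \<open>All approvers of the winner \<open>w\<close> lie outside
      \<open>G\<close>.\<close>
    have "approval_score N A w \<le> card (N - G)"
      unfolding approval_score_def w_def using none fin by (intro card_mono) auto
    also have "\<dots> = card N - card G"
      using fin G by (simp add: card_Diff_subset)
    finally have "approval_score N A w \<le> card N - card G" .
    moreover have "card {i \<in> G. c \<in> A i} \<le> approval_score N A w" if "c \<in> M" for c
    proof -
      have "card {i \<in> G. c \<in> A i} \<le> approval_score N A c"
        unfolding approval_score_def using fin G by (intro card_mono) auto
      also have "\<dots> \<le> approval_score N A w"
        using R inst that by (auto simp: approval_voting_rule_def w_def)
      finally show ?thesis .
    qed
    ultimately have le: "card {i \<in> G. c \<in> A i} \<le> card N - card G" if "c \<in> M" for c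
      using that le_trans by blast
    have "(\<Sum>i\<in>G. card (A i)) = (\<Sum>i\<in>G. card {c \<in> M. c \<in> A i})"
      using AM G by (intro sum.cong arg_cong[where f = card]) auto
    also have "\<dots> = (\<Sum>c\<in>M. card {i \<in> G. c \<in> A i})"
      using fin by (intro sum_multicount_gen) auto
    also have "\<dots> \<le> card M * (card N - card G)"
      using sum_bounded_above[OF le] by simp
    finally have "real (\<Sum>i\<in>G. card (A i)) \<le> real (card M * (card N - card G))"
      by (simp only: of_nat_le_iff)
    moreover have "s * real (card M) \<le> real (card (A i))" if "i \<in> G" for i
      using flex that M by (auto simp: flexible_def flexibility_def field_simps)
    then have "real (card G) * (s * real (card M)) \<le> (\<Sum>i\<in>G. real (card (A i)))"
      by (rule sum_bounded_below)
    \<comment> \<open>Since \<open>G \<subseteq> N\<close>, the truncated difference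
      \<open>card N - card G\<close> is a true one and carries over to the reals.\<close>
    ultimately have "real (card M) * (real (card G) * s) \<le> real (card M) * (real (card N) - real (card G))"
      using card_mono[OF fin(1) G] by (simp add: of_nat_diff algebra_simps)
    then have "real (card G) * s \<le> real (card N) - real (card G)"
      using M by (simp only: mult_le_cancel_left_pos of_nat_0_less_iff)
    with big s show False by (simp add: field_simps)
  qed
qed

text \<open>Adding \<open>i\<close> modulo \<open>g\<close> permutes the residues, so each of the
  \<open>p\<close> residues below \<open>p\<close> is hit exactly once.\<close>

lemma card_residues_shift_less:
  fixes i g p :: nat
  assumes "p \<le> g"
  shows "card {k. k < g \<and> (i + k) mod g < p} = p"
proof -
  have inj: "inj_on (\<lambda>k. (i + k) mod g) {..<g}"
  proof (rule inj_onI)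
    fix k l assume kl: "k \<in> {..<g}" "l \<in> {..<g}" and eq: "(i + k) mod g = (i + l) mod g"
    from eq have "k mod g = l mod g"
      by (simp add: nat_mod_eq_iff add.assoc)
    with kl show "k = l" by simp
  qed
  have "(\<lambda>k. (i + k) mod g) ` {..<g} = {..<g}"
    by (rule endo_inj_surj[OF _ _ inj]) auto
  then have "x \<in> (\<lambda>k. (i + k) mod g) ` {..<g}" if "x < p" for x
    using assms that by simp
  then have "(\<lambda>k. (i + k) mod g) ` {k. k < g \<and> (i + k) mod g < p} = {..<p}"
    by (fastforce simp: image_iff)
  then have "card {..<p} = card {k. k < g \<and> (i + k) mod g < p}"
    using card_image[OF inj_on_subset[OF inj, of "{k. k < g \<and> (i + k) mod g < p}"]] by auto
  then show ?thesis by simp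
qed

lemma approval_voting_unrepresented_group:
  fixes R :: "('v::infinite, 'c::infinite) rule"
  assumes R: "approval_voting_rule R" and pg: "p \<le> g"
  obtains N :: "'v set" and M :: "'c set" and A G
  where "approval_instance N M A" "G \<subseteq> N" "card G = g" "card N = g + p + 1" "card M = g + 1"
    "\<And>i. i \<in> G \<Longrightarrow> card (A i) = p" "\<And>i. i \<in> G \<Longrightarrow> R N M A \<notin> A i"
proof -
  obtain e :: "nat \<Rightarrow> 'v" where e: "inj e"
    using infinite_countable_subset[OF infinite_UNIV] by blast
  obtain f :: "nat \<Rightarrow> 'c" where f: "inj f"
    using infinite_countable_subset[OF infinite_UNIV] by blast
  define N where "N = e ` {..<g + p + 1}"
  define M where "M = f ` {..<g + 1}"
  \<comment> \<open>The condition is symmetric in \<open>i\<close> and \<open>k\<close>, so one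
    count gives both the size of the approval sets in the group and the scores of the candidates
    \<open>f k\<close> with \<open>k < g\<close>.\<close>
  define B where "B i = (if i < g then f ` {k. k < g \<and> (i + k) mod g < p} else {f g})" for i
  define A where "A = restrict (\<lambda>v. B (inv e v)) N"
  have A: "A (e i) = B i" if "i < g + p + 1" for i
    using that e by (simp add: A_def N_def)
  have inst: "approval_instance N M A"
    unfolding approval_instance_def A_def N_def M_def using e by (auto simp: B_def split: if_splits)
  have score: "approval_score N A c = card {i. i < g + p + 1 \<and> c \<in> B i}" for c
  proof -
    have "{v \<in> N. c \<in> A v} = e ` {i. i < g + p + 1 \<and> c \<in> B i}"
      using A by (auto simp: N_def)
    then show ?thesis
      unfolding approval_score_def using e by (simp add: card_image inj_on_subset)
  qed
  have "{i. i < g + p + 1 \<and> f g \<in> B i} = {g..<g + p + 1}"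
    using f by (auto simp: B_def inj_eq)
  then have score_extra: "approval_score N A (f g) = p + 1"
    by (simp add: score)
  have score_other: "approval_score N A (f k) = p" if "k < g" for k
  proof -
    have "{i. i < g + p + 1 \<and> f k \<in> B i} = {i. i < g \<and> (k + i) mod g < p}"
      using f that by (auto simp: B_def inj_eq add.commute)
    then show ?thesis
      by (simp add: score card_residues_shift_less[OF pg])
  qed
  have "R N M A \<in> M" and "approval_score N A (f g) \<le> approval_score N A (R N M A)"
    using R inst by (auto simp: approval_voting_rule_def single_winner_rule_def M_def)
  \<comment> \<open>The score \<open>p + 1\<close> beats every other score \<open>p\<close>
    strictly, so tie-breaking has no influence.\<close>
  then have winner: "R N M A = f g"
    using score_extra score_other by (force simp: M_def less_Suc_eq)
  show thesis
  proof (rule that[of N M A "e ` {..<g}"])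
    show "card (e ` {..<g}) = g" "card N = g + p + 1" "card M = g + 1"
      unfolding N_def M_def using e f by (auto simp: card_image inj_on_subset)
    show "card (A v) = p" if "v \<in> e ` {..<g}" for v
      using that f by (auto simp: A B_def card_image inj_on_subset card_residues_shift_less[OF pg])
    show "R N M A \<notin> A v" if "v \<in> e ` {..<g}" for v
      using that f by (auto simp: A B_def winner inj_eq)
  qed (use inst in \<open>auto simp: N_def\<close>)
qed

lemma approval_voting_represents_flexible_groups_ge:
  fixes R :: "('v::infinite, 'c::infinite) rule"
  assumes R: "approval_voting_rule R" and s: "s \<in> {0<..<1}" and r: "r \<ge> 0"
    and rep: "represents_flexible_groups R s r"
  shows "r \<ge> 1 / (1 + s)"
proof (rule ccontr)
  assume "\<not> ?thesis"
  then have d: "1 - r * (1 + s) > 0"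
    using s by (simp add: field_simps)
  \<comment> \<open>Both bounds come from \<open>p < s * (g + 1) + 1\<close>: the first forces
    \<open>p \<le> g\<close>, the second \<open>r * (g + p + 1) < g\<close>.\<close>
  define b where "b = max ((s + 1) / (1 - s)) (r * (s + 2) / (1 - r * (1 + s)))"
  obtain g :: nat where g: "real g > b"
    using reals_Archimedean2 by blast
  \<comment> \<open>The least approval count that is \<open>s\<close>-flexible among all
    \<open>g + 1\<close> candidates, the extra one included.\<close>
  define p where "p = nat \<lceil>s * (real g + 1)\<rceil>"
  have "s * (real g + 1) \<ge> 0" using s by simp
  then have p: "s * (real g + 1) \<le> real p" "real p < s * (real g + 1) + 1"
    unfolding p_def by linarith+
  have "real g * (1 - s) > s + 1" and gr: "real g * (1 - r * (1 + s)) > r * (s + 2)"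
    using g s d by (simp_all add: b_def pos_divide_less_eq)
  then have "p \<le> g"
    using p by (simp add: algebra_simps)
  then obtain N :: "'v set" and M :: "'c set" and A G
    where inst: "approval_instance N M A" "G \<subseteq> N"
      and cards: "card G = g" "card N = g + p + 1" "card M = g + 1"
      and A: "\<And>i. i \<in> G \<Longrightarrow> card (A i) = p" "\<And>i. i \<in> G \<Longrightarrow> R N M A \<notin> A i"
    using approval_voting_unrepresented_group[OF R] by blast
  have "r * real (card N) \<le> r * (real g + (s * (real g + 1) + 1) + 1)"
    using p r cards by (intro mult_left_mono) auto
  also have "\<dots> < real (card G)"
    using gr cards by (simp add: algebra_simps)
  finally have "r * real (card N) < real (card G)" .
  moreover have "flexible s M A i" if "i \<in> G" for i
    using A(1)[OF that] p cards by (simp add: flexible_def flexibility_def field_simps)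
  ultimately show False
    using rep inst A(2) unfolding represents_flexible_groups_def by blast
qed

theorem theorem2p3:
  fixes R :: "('v::infinite, 'c::infinite) rule" and s :: real
  assumes "approval_voting_rule R"
    and "s \<in> {0<..<1}"
  shows "FVR R s = 1 / (1 + s)"
  unfolding FVR_def
proof (rule Least_equality)
  show "1 / (1 + s) \<in> {0..1} \<and> represents_flexible_groups R s (1 / (1 + s))"
    using approval_voting_represents_flexible_groups[of R s] assms by auto
next
  fix r assume "r \<in> {0..1} \<and> represents_flexible_groups R s r"
  then show "1 / (1 + s) \<le> r"
    using approval_voting_represents_flexible_groups_ge[OF assms] by auto
qed

end
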